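(* For all positive integers $k_1,k_2,\ldots,k_n$ with $k_1\ge 2$, \[ \sum_{i=1}^{n}\bigl(k_i-1+\delta_{ni}\bigr)\,\overline{\zeta}(k_1,\ldots,k_{i-1},k_i+1,k_{i+1},\ldots,k_n) =\sum_{\substack{1\le i\le n\\ k_i\ge 2}}\ \sum_{j=0}^{k_i-2}\overline{\zeta}(k_1,\ldots,k_{i-1},k_i-j,j+1,k_{i+1},\ldots,k_n), \] where $\delta_{ni}$ is the Kronecker delta ($1$ if $i=n$, $0$ otherwise).
   Context: For positive integers $k_1,\ldots,k_n$ with $k_1\ge2$, the non-strict multiple zeta value is $\overline{\zeta}(k_1,\ldots,k_n)=\sum_{m_1\ge m_2\ge\cdots\ge m_n>0}\frac{1}{m_1^{k_1}m_2^{k_2}\cdots m_n^{k_n}}$. *)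

theory Defs
  imports "HOL-Analysis.Infinite_Sum"
begin

text \<open>Multi-indices and summation indices are lists: entry \<open>ks ! i\<close> is $k_{i+1}$.\<close>

definition mzv_indices :: "nat \<Rightarrow> nat list set" where
  "mzv_indices n = {ms. length ms = n \<and> sorted_wrt (\<ge>) ms \<and> (\<forall>m\<in>set ms. m > 0)}"

text \<open>The terms are nonnegative, so the unordered sum is the usual multiple series.
  As usual for \<^const>\<open>infsum\<close>, the value is meaningful only for convergent series,
  i.e.\ if the entries of \<open>ks\<close> are positive and the first one is at least 2.\<close>

definition zeta_bar :: "nat list \<Rightarrow> real" where
  "zeta_bar ks =
     (\<Sum>\<^sub>\<infinity>ms\<in>mzv_indices (length ks). 1 / (\<Prod>i<length ks. real (ms ! i) ^ (ks ! i)))"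

end

theory Submission
  imports Defs "HOL-Analysis.Harmonic_Numbers" "HOL-Analysis.Summation_Tests"
begin

text \<open>
  Write $P(m) = \prod_i m_i^{-k_i}$. In the inner sum over $j$ on the right-hand side for position
  $i$, name the two adjacent summation variables $q \ge p$. The terms with $q = p$ add up to
  $k_i - 1$ times the value with $k_i$ incremented. For $q > p$ the geometric sum over $j$ is
  $p^{-k_i}(1/(q-p) - 1/q) - q^{-k_i}/(q-p)$. Each of the two parts depends on one of $p$, $q$ only
  through the bracket; summing out that variable leaves $P(m)$ times the weights
  $H_{m_{i-1}-m_i} - H_{m_{i-1}} + H_{m_i}$ (which is $H_{m_1}$ for $i = 1$) and $H_{m_i-m_{i+1}}$
  (which is $H_{m_n-1}$ for $i = n$), where $H$ denotes harmonic numbers. Summed over $i$, the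
  difference of the weights telescopes to $H_{m_n} - H_{m_n-1} = 1/m_n$, which increments $k_n$.
\<close>

section \<open>Multiplicativity of the summand\<close>

definition zeta_term :: "nat list \<Rightarrow> nat list \<Rightarrow> real" where
  "zeta_term ks ms = 1 / (\<Prod>i<length ks. real (ms ! i) ^ (ks ! i))"

lemma zeta_bar_altdef: "zeta_bar ks = infsum (zeta_term ks) (mzv_indices (length ks))"
  by (simp add: zeta_bar_def zeta_term_def[abs_def])

lemma zeta_term_Nil [simp]: "zeta_term [] ms = 1"
  by (simp add: zeta_term_def)

lemma zeta_term_Cons [simp]: "zeta_term (k # ks) (m # ms) = 1 / real m ^ k * zeta_term ks ms"
  by (simp add: zeta_term_def prod.lessThan_Suc_shift del: prod.lessThan_Suc)

lemma zeta_term_append: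
  "length xs = length as \<Longrightarrow> zeta_term (xs @ ys) (as @ bs) = zeta_term xs as * zeta_term ys bs"
  by (induction xs as rule: list_induct2) auto

lemma zeta_term_nonneg [simp]: "zeta_term ks ms \<ge> 0"
  by (auto simp: zeta_term_def intro!: divide_nonneg_nonneg prod_nonneg)

section \<open>Harmonic numbers: growth and sums of reciprocals\<close>

text \<open>Any bound by a power below 1 would give convergence later. The square root makes the
  induction step elementary: 2 * (sqrt(n+1) - sqrt n) is at least 1/(n+1).\<close>

lemma harm_le_sqrt: "harm n \<le> 2 * sqrt (real n)"
proof (induction n)
  case (Suc n)
  define a where "a = sqrt (real n)"
  define b where "b = sqrt (real n + 1)"
  have ab: "0 \<le> a" "a \<le> b" "0 < b" "a\<^sup>2 = real n" "b\<^sup>2 = real n + 1"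
    by (auto simp: a_def b_def)
  have "1 = (b - a) * (b + a)"
    using ab by (simp add: algebra_simps power2_eq_square)
  also have "\<dots> \<le> (b - a) * (2 * b)"
    using ab by (intro mult_left_mono) auto
  also have "\<dots> \<le> (b - a) * (2 * b\<^sup>2)"
  proof (rule mult_left_mono)
    have "1 \<le> b" by (simp add: b_def)
    thus "2 * b \<le> 2 * b\<^sup>2" by (simp add: power2_eq_square)
  qed (use ab in auto)
  finally have "1 / b\<^sup>2 \<le> 2 * b - 2 * a"
    using ab by (simp add: divide_simps algebra_simps)
  moreover have "harm (Suc n) = harm n + 1 / b\<^sup>2"
    using ab by (simp add: harm_Suc field_simps)
  ultimately show ?case
    using Suc unfolding a_def b_def by (simp add: add.commute)
qed (simp add: harm_def)

text \<open>Passing from m to m + 1 adds a telescoping series with sum 1/(m+1).\<close>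

lemma sums_shifted_reciprocals: "(\<lambda>t. 1 / real (t + 1) - 1 / real (t + 1 + m)) sums harm m"
proof (induction m)
  case (Suc m)
  have "(\<lambda>t. 1 / real (t + 1 + m)) \<longlonglongrightarrow> 0"
    using LIMSEQ_ignore_initial_segment[OF lim_1_over_n, of "Suc m"] by (simp add: add_ac)
  from telescope_sums'[OF this]
  have "(\<lambda>t. 1 / real (t + 1 + m) - 1 / real (Suc t + 1 + m)) sums (1 / real (0 + 1 + m) - 0)" .
  from sums_add[OF Suc this] show ?case
    by (simp add: harm_Suc inverse_eq_divide add_ac)
qed (simp add: harm_def)

text \<open>Needed for the first variable, the only one without an upper bound. The two fractions
  must stay together, since neither is summable alone.\<close>

lemma has_sum_reciprocal_diff_greaterThan:
  "((\<lambda>q. 1 / real (q - m) - 1 / real q) has_sum harm m) {m<..}"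
proof -
  have "((\<lambda>t. 1 / real (t + 1) - 1 / real (t + 1 + m)) has_sum harm m) UNIV"
    by (rule sums_nonneg_imp_has_sum[OF sums_shifted_reciprocals])
       (auto simp: field_simps)
  also have "?this \<longleftrightarrow> ?thesis"
    by (intro has_sum_reindex_bij_witness[of _ "\<lambda>q. q - m - 1" "\<lambda>t. t + 1 + m"]) auto
  finally show ?thesis .
qed

lemma sum_reciprocal_Ioc: "m \<le> n \<Longrightarrow> (\<Sum>q\<in>{m<..n}. 1 / real q) = harm n - harm m"
proof (induction n rule: dec_induct)
  case (step n)
  have "{m<..Suc n} = insert (Suc n) {m<..n}" using step by auto
  thus ?case using step by (simp add: harm_Suc inverse_eq_divide)
qed simp

lemma sum_reciprocal_diff_Ioc: "m \<le> n \<Longrightarrow> (\<Sum>q\<in>{m<..n}. 1 / real (q - m)) = harm (n - m)"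
proof -
  assume "m \<le> n"
  have "(\<Sum>q\<in>{m<..n}. 1 / real (q - m)) = (\<Sum>q\<in>{1..n-m}. inverse (real q))"
    by (rule sum.reindex_bij_witness[of _ "\<lambda>q. q + m" "\<lambda>q. q - m"])
       (use \<open>m \<le> n\<close> in \<open>auto simp: field_simps\<close>)
  thus ?thesis by (simp add: harm_def)
qed

lemma sum_reciprocal_diff_Ico: "m \<le> n \<Longrightarrow> (\<Sum>p\<in>{m..<n}. 1 / real (n - p)) = harm (n - m)"
proof -
  assume "m \<le> n"
  have "(\<Sum>p\<in>{m..<n}. 1 / real (n - p)) = (\<Sum>q\<in>{1..n-m}. inverse (real q))"
    by (rule sum.reindex_bij_witness[of _ "\<lambda>q. n - q" "\<lambda>q. n - q"])
       (use \<open>m \<le> n\<close> in \<open>auto simp: field_simps\<close>)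
  thus ?thesis by (simp add: harm_def)
qed

section \<open>Convergence of the series, with and without harmonic weights\<close>

lemma mzv_indices_nth_mono:
  "ms \<in> mzv_indices n \<Longrightarrow> i \<le> j \<Longrightarrow> j < n \<Longrightarrow> ms ! j \<le> ms ! i"
  by (cases "i = j") (auto simp: mzv_indices_def sorted_wrt_iff_nth_less)

lemma mzv_indices_nth_pos: "ms \<in> mzv_indices n \<Longrightarrow> i < n \<Longrightarrow> 0 < ms ! i"
  by (auto simp: mzv_indices_def)

lemma length_mzv_indices: "ms \<in> mzv_indices n \<Longrightarrow> length ms = n"
  by (simp add: mzv_indices_def)

text \<open>Dropping the ordering constraint makes the sum factor into n convergent one-variable
  series. Entries 0 do no harm because \<open>0 powr s = 0\<close>.\<close>

lemma prod_list_powr_summable: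
  assumes "s < -1"
  shows "(\<lambda>ms. \<Prod>m\<leftarrow>ms. real m powr s) summable_on {ms. length ms = n}"
proof (induction n)
  case (Suc n)
  define S where "S = (\<Sum>\<^sub>\<infinity>ms | length ms = n. \<Prod>m\<leftarrow>ms. real m powr s)"
  have inner: "((\<lambda>ms. \<Prod>m\<leftarrow>ms. real m powr s) has_sum S) {ms. length ms = n}"
    unfolding S_def by (rule has_sum_infsum[OF Suc])
  have outer: "(\<lambda>m. real m powr s) summable_on UNIV"
    using assms by (intro summable_nonneg_imp_summable_on) (auto simp: summable_real_powr_iff)
  have "(\<lambda>(m, ms). real m powr s * (\<Prod>m\<leftarrow>ms. real m powr s)) summable_on
          (UNIV \<times> {ms. length ms = n})"
    by (rule summable_on_SigmaI[where g = "\<lambda>m. real m powr s * S"])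
       (auto intro!: has_sum_cmult_right inner summable_on_cmult_left outer
                     mult_nonneg_nonneg prod_list_nonneg)
  also have "?this \<longleftrightarrow> ?case"
    by (rule summable_on_reindex_bij_witness[of _ "\<lambda>ms. (hd ms, tl ms)" "\<lambda>(m, ms). m # ms"])
       (auto simp: length_Suc_conv)
  finally show ?case .
qed simp

text \<open>Each entry m receives one of the factors a^(-e), which is at most m^(-e), while m^(-k)
  is at most m^(-1).\<close>

lemma zeta_term_le_prod_powr:
  fixes e :: real
  assumes "length ks = length ms" "\<forall>k\<in>set ks. k > 0" "\<forall>m\<in>set ms. 0 < m \<and> m \<le> a" "e \<ge> 0"
  shows "zeta_term ks ms * real a powr (- e * length ms) \<le> (\<Prod>m\<leftarrow>ms. real m powr (- 1 - e))"
  using assms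
proof (induction ks ms rule: list_induct2)
  case (Cons k ks m ms)
  have am: "0 < m" "m \<le> a" "0 < k" using Cons by auto
  have "zeta_term (k # ks) (m # ms) * real a powr (- e * length (m # ms)) =
        (1 / real m ^ k * real a powr - e) * (zeta_term ks ms * real a powr (- e * length ms))"
    by (simp add: algebra_simps flip: powr_add)
  also have "\<dots> \<le> (real m powr (-1) * real m powr - e) * (\<Prod>m\<leftarrow>ms. real m powr (- 1 - e))"
  proof (intro mult_mono)
    show "1 / real m ^ k \<le> real m powr -1"
    proof -
      have "real m ^ 1 \<le> real m ^ k" using am by (intro power_increasing) auto
      thus ?thesis using am by (simp add: powr_minus divide_simps)
    qed
    show "real a powr - e \<le> real m powr - e"
      using am Cons by (intro powr_mono2') auto
  qed (use Cons in \<open>auto intro!: mult_nonneg_nonneg prod_list_nonneg\<close>)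
  also have "real m powr (-1) * real m powr - e = real m powr (- 1 - e)"
    using powr_add[of "real m" "-1" "-e"] by simp
  finally show ?case by simp
qed simp

text \<open>Since $m_i \le m_1$, the factor $m_1^{-1/2}$ gained from $k_1 \ge 2$ and $H_m \le 2\sqrt m$ can be
  shared out equally among the $n$ variables, which leaves a product of convergent series.\<close>
lemma zeta_term_harm_summable:
  assumes "ks \<noteq> []" "\<forall>k\<in>set ks. k > 0" "ks ! 0 \<ge> 2"
  shows "(\<lambda>ms. zeta_term ks ms * harm (ms ! 0)) summable_on mzv_indices (length ks)"
proof -
  define n where "n = length ks"
  define e where "e = 1 / (2 * real n)"
  have n: "n > 0" using assms by (simp add: n_def)
  have e: "e > 0" "e * n = 1 / 2" using n by (auto simp: e_def)
  have "(\<lambda>ms. 2 * (\<Prod>m\<leftarrow>ms. real m powr (- 1 - e))) summable_on mzv_indices n"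
    by (rule summable_on_subset_banach[OF summable_on_cmult_right[OF prod_list_powr_summable[where n = n]]])
       (use e in \<open>auto simp: mzv_indices_def\<close>)
  hence "(\<lambda>ms. zeta_term ks ms * harm (ms ! 0)) summable_on mzv_indices n"
  proof (rule summable_on_comparison_test)
    fix ms assume ms: "ms \<in> mzv_indices n"
    obtain k ks' where ks: "ks = k # ks'" using assms by (cases ks) auto
    obtain m ms' where ms_eq: "ms = m # ms'"
      using ms n by (cases ms) (auto simp: mzv_indices_def)
    have k: "k \<ge> 2" and ks': "\<forall>k\<in>set ks'. k > 0" using assms ks by auto
    have m: "m > 0" "\<forall>x\<in>set ms'. 0 < x \<and> x \<le> m" and len: "length ks' = length ms'"
      using ms by (auto simp: ms_eq mzv_indices_def n_def ks)
    have "zeta_term ks ms * harm (ms ! 0) = (1 / real m ^ k * harm m) * zeta_term ks' ms'"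
      by (simp add: ks ms_eq)
    also have "\<dots> \<le> (2 * (real m powr (-1 - e) * real m powr (- e * length ms'))) * zeta_term ks' ms'"
    proof (rule mult_right_mono)
      have "real m ^ 2 \<le> real m ^ k" using m k by (intro power_increasing) auto
      hence "1 / real m ^ k * harm m \<le> 1 / real m ^ 2 * (2 * sqrt (real m))"
        using m by (intro mult_mono harm_le_sqrt harm_nonneg) (auto simp: divide_simps)
      also have "\<dots> = 2 * (real m powr (-2) * real m powr (1 / 2))"
        using m by (simp add: powr_minus powr_half_sqrt divide_simps)
      \<comment> \<open>The exponent -3/2 is -1 - e*n. One share e stays with the first entry; the
        other n - 1 shares are passed to the tail.\<close>
      also have "real m powr (-2) * real m powr (1 / 2) = real m powr (-1 - e * n)"
        by (simp only: e flip: powr_add) simp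
      also have "-1 - e * n = (-1 - e) + (- e * length ms')"
        using len by (simp add: n_def ks algebra_simps)
      finally show "1 / real m ^ k * harm m \<le>
          2 * (real m powr (-1 - e) * real m powr (- e * length ms'))"
        by (simp only: powr_add)
    qed simp
    also have "\<dots> = 2 * real m powr (-1 - e) *
        (zeta_term ks' ms' * real m powr (- e * length ms'))"
      by simp
    also have "\<dots> \<le> 2 * real m powr (-1 - e) * (\<Prod>m\<leftarrow>ms'. real m powr (- 1 - e))"
      using m ks' len e by (intro mult_left_mono zeta_term_le_prod_powr) simp_all
    finally show "zeta_term ks ms * harm (ms ! 0) \<le> 2 * (\<Prod>m\<leftarrow>ms. real m powr (- 1 - e))"
      by (simp add: ms_eq)
  qed (auto intro!: mult_nonneg_nonneg harm_nonneg)
  thus ?thesis by (simp add: n_def)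
qed

text \<open>One comparison serves both families of weights and, with weight 1, the unweighted
  series.\<close>

lemma zeta_term_mult_summable:
  assumes "ks \<noteq> []" "\<forall>k\<in>set ks. k > 0" "ks ! 0 \<ge> 2"
  assumes "\<And>ms. ms \<in> mzv_indices (length ks) \<Longrightarrow> 0 \<le> w ms \<and> w ms \<le> harm (ms ! 0)"
  shows "(\<lambda>ms. zeta_term ks ms * w ms) summable_on mzv_indices (length ks)"
  by (rule summable_on_comparison_test[OF zeta_term_harm_summable[OF assms(1-3)]])
     (use assms(4) in \<open>auto intro!: mult_left_mono mult_nonneg_nonneg\<close>)

lemma one_le_harm: "0 < m \<Longrightarrow> (1 :: real) \<le> harm m"
  using harm_mono[of 1 m, where ?'a = real] by (simp add: harm_def)

lemma zeta_term_summable: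
  assumes "ks \<noteq> []" "\<forall>k\<in>set ks. k > 0" "ks ! 0 \<ge> 2"
  shows "zeta_term ks summable_on mzv_indices (length ks)"
  using zeta_term_mult_summable[OF assms, of "\<lambda>_. 1"] assms
  by (auto intro!: one_le_harm mzv_indices_nth_pos)

section \<open>Summing out one entry of a decreasing list\<close>

abbreviation insert_nth :: "nat \<Rightarrow> 'a \<Rightarrow> 'a list \<Rightarrow> 'a list" where
  "insert_nth j q ms \<equiv> take j ms @ q # drop j ms"

abbreviation delete_nth :: "nat \<Rightarrow> 'a list \<Rightarrow> 'a list" where
  "delete_nth j ms \<equiv> take j ms @ drop (Suc j) ms"

text \<open>In a decreasing list only the two neighbours constrain a new entry, so the range of a
  summed-out variable is an interval.\<close>

lemma insert_nth_in_mzv_indices_iff: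
  assumes "ms \<in> mzv_indices n" "j \<le> n"
  shows "insert_nth j q ms \<in> mzv_indices (Suc n) \<longleftrightarrow>
    0 < q \<and> (0 < j \<longrightarrow> q \<le> ms ! (j - 1)) \<and> (j < n \<longrightarrow> ms ! j \<le> q)"
proof -
  have len: "length ms = n" using assms by (simp add: mzv_indices_def)
  have srt: "sorted_wrt (\<ge>) (take j ms @ drop j ms)" and pos: "\<forall>m\<in>set ms. 0 < m"
    using assms by (simp_all add: mzv_indices_def)
  have pos': "\<forall>m\<in>set (take j ms) \<union> set (drop j ms). 0 < m"
    using pos set_take_subset set_drop_subset by fastforce
  have 1: "(\<forall>x\<in>set (take j ms). q \<le> x) \<longleftrightarrow> (0 < j \<longrightarrow> q \<le> ms ! (j - 1))"
  proof (intro iffI impI ballI)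
    assume "\<forall>x\<in>set (take j ms). q \<le> x" "0 < j"
    moreover have "ms ! (j - 1) \<in> set (take j ms)"
      using \<open>0 < j\<close> assms len by (auto simp: in_set_conv_nth intro!: exI[of _ "j - 1"])
    ultimately show "q \<le> ms ! (j - 1)" by blast
  next
    fix x assume x: "0 < j \<longrightarrow> q \<le> ms ! (j - 1)" "x \<in> set (take j ms)"
    then obtain i where "i < j" "x = ms ! i" by (auto simp: in_set_conv_nth)
    with x mzv_indices_nth_mono[OF assms(1), of i "j - 1"] assms show "q \<le> x" by force
  qed
  have 2: "(\<forall>x\<in>set (drop j ms). x \<le> q) \<longleftrightarrow> (j < n \<longrightarrow> ms ! j \<le> q)"
  proof (intro iffI impI ballI)
    assume "\<forall>x\<in>set (drop j ms). x \<le> q" "j < n"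
    moreover have "ms ! j \<in> set (drop j ms)"
      using \<open>j < n\<close> len by (auto simp: in_set_conv_nth intro!: exI[of _ 0])
    ultimately show "ms ! j \<le> q" by blast
  next
    fix x assume x: "j < n \<longrightarrow> ms ! j \<le> q" "x \<in> set (drop j ms)"
    then obtain i where "i < length (drop j ms)" "x = drop j ms ! i"
      unfolding in_set_conv_nth by blast
    hence "j + i < n" "x = ms ! (j + i)" using len by auto
    with x mzv_indices_nth_mono[OF assms(1), of j "j + i"] assms show "x \<le> q" by auto
  qed
  show ?thesis
    using srt pos' len assms unfolding mzv_indices_def 1[symmetric] 2[symmetric]
    by (auto simp: sorted_wrt_append intro: order.trans[of _ q])
qed

lemma delete_nth_in_mzv_indices:
  assumes "l \<in> mzv_indices (Suc n)" "j \<le> n"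
  shows "delete_nth j l \<in> mzv_indices n"
proof -
  obtain xs x ys where l: "l = xs @ x # ys" "length xs = j"
    using assms id_take_nth_drop[of j l] by (force simp: mzv_indices_def)
  show ?thesis
    using assms unfolding l(1) mzv_indices_def by (auto simp: sorted_wrt_append l(2))
qed

text \<open>Fubini for nonnegative terms: a list corresponds to the pair of its shortened list and
  its entry at j. Summability over D follows from that of the inner sums g.\<close>

lemma has_sum_insert_nth:
  fixes h :: "nat list \<Rightarrow> real"
  assumes j: "j \<le> n" and D: "D \<subseteq> mzv_indices (Suc n)"
    and nonneg: "\<And>l. l \<in> D \<Longrightarrow> 0 \<le> h l"
    and inner: "\<And>ms. ms \<in> mzv_indices n \<Longrightarrow>
      ((\<lambda>q. h (insert_nth j q ms)) has_sum g ms) {q. insert_nth j q ms \<in> D}"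
    and g: "g summable_on mzv_indices n"
  shows "(h has_sum infsum g (mzv_indices n)) D"
proof -
  let ?A = "Sigma (mzv_indices n) (\<lambda>ms. {q. insert_nth j q ms \<in> D})"
  have "(\<lambda>(ms, q). h (insert_nth j q ms)) summable_on ?A"
    by (rule summable_on_SigmaI[OF _ g]) (use inner nonneg in auto)
  hence "((\<lambda>(ms, q). h (insert_nth j q ms)) has_sum infsum g (mzv_indices n)) ?A"
    by (intro has_sum_SigmaI[OF _ has_sum_infsum[OF g]]) (use inner in auto)
  also have "?this \<longleftrightarrow> ?thesis"
  proof (rule has_sum_reindex_bij_witness[of _ "\<lambda>l. (delete_nth j l, l ! j)"
        "\<lambda>(ms, q). insert_nth j q ms"])
    fix l assume "l \<in> D"
    hence l: "l \<in> mzv_indices (Suc n)" using D by auto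
    hence len: "length l = Suc n" by (rule length_mzv_indices)
    have eq: "insert_nth j (l ! j) (delete_nth j l) = l"
      using len j by (simp add: Cons_nth_drop_Suc)
    thus "(case (delete_nth j l, l ! j) of (ms, q) \<Rightarrow> insert_nth j q ms) = l" by simp
    show "(delete_nth j l, l ! j) \<in> ?A"
      using delete_nth_in_mzv_indices[OF l j] eq \<open>l \<in> D\<close> by auto
  next
    fix a assume "a \<in> ?A"
    then obtain ms q where a: "a = (ms, q)" "ms \<in> mzv_indices n" by auto
    hence len: "length ms = n" by (auto simp: mzv_indices_def)
    thus "(delete_nth j (case a of (ms, q) \<Rightarrow> insert_nth j q ms),
           (case a of (ms, q) \<Rightarrow> insert_nth j q ms) ! j) = a"
      using a j by (simp add: nth_append)
  qed auto
  finally show ?thesis .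
qed


section \<open>Partial fractions in two adjacent variables\<close>

lemma has_sum_sum:
  fixes f :: "'i \<Rightarrow> 'a \<Rightarrow> 'b::topological_comm_monoid_add"
  assumes "finite I" "\<And>i. i \<in> I \<Longrightarrow> (f i has_sum s i) A"
  shows "((\<lambda>x. \<Sum>i\<in>I. f i x) has_sum (\<Sum>i\<in>I. s i)) A"
  using assms by (induction I rule: finite_induct) (auto intro: has_sum_add has_sum_0)

text \<open>The closed form of a finite geometric sum, with its negative part moved to the left so
  that only nonnegative terms occur. Raising r by one divides the old left side by x and adds the
  single new term j = r.\<close>

lemma partial_fractions:
  fixes x y :: real
  assumes "0 < y" "y < x"
  shows "(\<Sum>j<r. 1 / x ^ (Suc r - j) * (1 / y ^ (j + 1))) + 1 / x ^ Suc r * (1 / (x - y)) =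
         1 / y ^ Suc r * (1 / (x - y) - 1 / x)"
proof (induction r)
  case 0
  show ?case using assms by (simp add: field_simps)
next
  case (Suc r)
  have "(\<Sum>j<Suc r. 1 / x ^ (Suc (Suc r) - j) * (1 / y ^ (j + 1))) =
        (\<Sum>j<r. 1 / x ^ (Suc r - j) * (1 / y ^ (j + 1))) / x + 1 / x ^ 2 * (1 / y ^ (r + 1))"
    by (simp add: sum_divide_distrib Suc_diff_le power2_eq_square mult_ac)
  hence "(\<Sum>j<Suc r. 1 / x ^ (Suc (Suc r) - j) * (1 / y ^ (j + 1))) +
          1 / x ^ Suc (Suc r) * (1 / (x - y)) =
        ((\<Sum>j<r. 1 / x ^ (Suc r - j) * (1 / y ^ (j + 1))) + 1 / x ^ Suc r * (1 / (x - y))) / x +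
          1 / x ^ 2 * (1 / y ^ (r + 1))"
    by (simp add: add_divide_distrib mult_ac)
  also have "\<dots> = 1 / y ^ Suc r * (1 / (x - y) - 1 / x) / x + 1 / x ^ 2 * (1 / y ^ (r + 1))"
    by (simp only: Suc)
  also have "\<dots> = 1 / y ^ Suc (Suc r) * (1 / (x - y) - 1 / x)"
    using assms by (simp add: divide_simps power2_eq_square)
  finally show ?case .
qed

text \<open>\<open>partial_fractions\<close> with x = q, y = p, r = k - 1, times the factors of the
  other entries. In each term with the shorter index, one of p and q survives only in the
  bracket.\<close>

lemma zeta_term_partial_fractions:
  assumes "length xs = length as" "0 < p" "p < q" "0 < k"
  shows "(\<Sum>j<k-1. zeta_term (xs @ [k - j, j + 1] @ ys) (as @ q # p # bs)) +
           zeta_term (xs @ k # ys) (as @ q # bs) * (1 / real (q - p)) =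
         zeta_term (xs @ k # ys) (as @ p # bs) * (1 / real (q - p) - 1 / real q)"
proof -
  obtain r where k: "k = Suc r" using assms(4) by (cases k) auto
  let ?c = "zeta_term xs as * zeta_term ys bs"
  have "(\<Sum>j<k-1. zeta_term (xs @ [k - j, j + 1] @ ys) (as @ q # p # bs)) +
           zeta_term (xs @ k # ys) (as @ q # bs) * (1 / real (q - p)) =
        ?c * ((\<Sum>j<r. 1 / real q ^ (Suc r - j) * (1 / real p ^ (j + 1))) +
              1 / real q ^ Suc r * (1 / (real q - real p)))"
    using assms by (simp add: zeta_term_append k sum_distrib_left algebra_simps)
  also have "\<dots> = ?c * (1 / real p ^ Suc r * (1 / (real q - real p) - 1 / real q))"
    using assms by (subst partial_fractions) auto
  also have "\<dots> = zeta_term (xs @ k # ys) (as @ p # bs) * (1 / real (q - p) - 1 / real q)"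
    using assms by (simp add: zeta_term_append k)
  finally show ?thesis .
qed

text \<open>On equal entries the exponents k - j and j + 1 add up to k + 1 for every j, so all k - 1
  terms agree.\<close>

lemma zeta_term_equal_entries:
  assumes "length xs = length as" "0 < p" "0 < k"
  shows "(\<Sum>j<k-1. zeta_term (xs @ [k - j, j + 1] @ ys) (as @ p # p # bs)) =
         (real k - 1) * zeta_term (xs @ [k + 1] @ ys) (as @ p # bs)"
proof -
  have "zeta_term (xs @ [k - j, j + 1] @ ys) (as @ p # p # bs) =
        zeta_term (xs @ [k + 1] @ ys) (as @ p # bs)" if "j < k - 1" for j
  proof -
    have "real p ^ (k - j) * real p ^ (j + 1) = real p ^ (k + 1)"
      using that by (simp flip: power_add)
    thus ?thesis using assms by (simp add: zeta_term_append field_simps)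
  qed
  thus ?thesis using assms by (simp add: of_nat_diff)
qed

section \<open>The harmonic weights and their telescoping sum\<close>

locale admissible_index =
  fixes ks :: "nat list"
  assumes nonempty: "ks \<noteq> []" and pos: "\<forall>k\<in>set ks. k > 0" and first: "ks ! 0 \<ge> 2"
begin

text \<open>The sum of 1/(q - m) - 1/q over q > m, where m is \<open>ms ! i\<close> and q is at most
  the preceding entry, or unbounded if i = 0.\<close>

definition upper_weight :: "nat \<Rightarrow> nat list \<Rightarrow> real" where
  "upper_weight i ms = (if i = 0 then harm (ms ! 0)
     else harm (ms ! (i - 1) - ms ! i) - harm (ms ! (i - 1)) + harm (ms ! i))"

text \<open>The sum of 1/(m - p) over p < m, where m is \<open>ms ! i\<close> and p is at least the
  next entry, or at least 1 if there is none.\<close>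

definition lower_weight :: "nat \<Rightarrow> nat list \<Rightarrow> real" where
  "lower_weight i ms = harm (ms ! i - (if Suc i < length ks then ms ! Suc i else 1))"

definition strict_at :: "nat \<Rightarrow> nat list set" where
  "strict_at i = {l \<in> mzv_indices (Suc (length ks)). l ! Suc i < l ! i}"

definition equal_at :: "nat \<Rightarrow> nat list set" where
  "equal_at i = {l \<in> mzv_indices (Suc (length ks)). l ! Suc i = l ! i}"

lemma length_pos: "0 < length ks"
  using nonempty by simp

text \<open>With a = \<open>ms ! i\<close> and b the entry before it, nonnegativity follows termwise
  from 1/q <= 1/(q - a). The upper bound uses H_(b-a) <= H_b, which leaves H_a.\<close>

lemma upper_weight_bounds:
  assumes "ms \<in> mzv_indices (length ks)" "i < length ks"
  shows "0 \<le> upper_weight i ms \<and> upper_weight i ms \<le> harm (ms ! 0)"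
proof (cases "i = 0")
  case False
  let ?b = "ms ! (i - 1)" and ?a = "ms ! i"
  have ab: "?a \<le> ?b" "?a \<le> ms ! 0"
    using assms False by (auto intro: mzv_indices_nth_mono)
  have "(\<Sum>q\<in>{?a<..?b}. 1 / real q) \<le> (\<Sum>q\<in>{?a<..?b}. 1 / real (q - ?a))"
    by (intro sum_mono) (auto simp: divide_simps)
  hence "harm ?b - harm ?a \<le> (harm (?b - ?a) :: real)"
    by (simp only: sum_reciprocal_Ioc[OF ab(1)] sum_reciprocal_diff_Ioc[OF ab(1)])
  moreover have "harm (?b - ?a) \<le> (harm ?b :: real)" "harm ?a \<le> (harm (ms ! 0) :: real)"
    using ab by (auto intro!: harm_mono)
  ultimately show ?thesis using False by (simp add: upper_weight_def)
qed (auto simp: upper_weight_def harm_nonneg)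

lemma lower_weight_bounds:
  assumes "ms \<in> mzv_indices (length ks)" "i < length ks"
  shows "0 \<le> lower_weight i ms \<and> lower_weight i ms \<le> harm (ms ! 0)"
  using mzv_indices_nth_mono[OF assms(1) _ assms(2), of 0]
  by (auto simp: lower_weight_def harm_nonneg intro!: harm_mono)

text \<open>After an index shift the terms H(m_i - m_(i+1)) occur on both sides. The rest of the
  left side telescopes to H(m_n), while the last lower weight is H(m_n - 1).\<close>

lemma sum_weights:
  assumes ms: "ms \<in> mzv_indices (length ks)"
  shows "(\<Sum>i<length ks. upper_weight i ms) =
    (\<Sum>i<length ks. lower_weight i ms) + 1 / real (ms ! (length ks - 1))"
proof -
  obtain r where r: "length ks = Suc r" using length_pos by (cases "length ks") auto
  have "0 < ms ! r" using ms r by (intro mzv_indices_nth_pos[of _ "Suc r"]) auto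
  hence last: "harm (ms ! r) = harm (ms ! r - 1) + 1 / real (ms ! r)"
    by (cases "ms ! r") (auto simp: harm_Suc inverse_eq_divide)
  have "(\<Sum>i<Suc r. upper_weight i ms) =
      harm (ms ! 0) + (\<Sum>i<r. harm (ms ! i - ms ! Suc i) + (harm (ms ! Suc i) - harm (ms ! i)))"
    by (simp add: sum.lessThan_Suc_shift upper_weight_def algebra_simps del: sum.lessThan_Suc)
  also have "\<dots> = (\<Sum>i<r. harm (ms ! i - ms ! Suc i)) + harm (ms ! r)"
    using sum_lessThan_telescope[of "\<lambda>i. harm (ms ! i) :: real" r] by (simp add: sum.distrib)
  also have "(\<Sum>i<r. harm (ms ! i - ms ! Suc i)) = (\<Sum>i<r. lower_weight i ms)"
    by (simp add: lower_weight_def r)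
  finally show ?thesis by (simp add: r last lower_weight_def)
qed

section \<open>Summing out the larger or the smaller of two adjacent variables\<close>

lemma upper_has_sum:
  assumes i: "i < length ks"
  shows "((\<lambda>l. zeta_term ks (delete_nth i l) * (1 / real (l ! i - l ! Suc i) - 1 / real (l ! i)))
    has_sum (\<Sum>\<^sub>\<infinity>ms\<in>mzv_indices (length ks). zeta_term ks ms * upper_weight i ms)) (strict_at i)"
proof (rule has_sum_insert_nth[where j = i])
  fix l assume "l \<in> strict_at i"
  thus "0 \<le> zeta_term ks (delete_nth i l) * (1 / real (l ! i - l ! Suc i) - 1 / real (l ! i))"
    by (intro mult_nonneg_nonneg) (auto simp: strict_at_def divide_simps)
next
  fix ms assume ms: "ms \<in> mzv_indices (length ks)"
  hence len: "length ms = length ks" by (rule length_mzv_indices)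
  let ?Q = "{q. insert_nth i q ms \<in> strict_at i}"
  have Q: "?Q = (if i = 0 then {ms ! i<..} else {ms ! i<..ms ! (i - 1)})"
  proof (rule set_eqI)
    fix q
    have nth: "insert_nth i q ms ! i = q" "insert_nth i q ms ! Suc i = ms ! i"
      using i len by (simp_all add: nth_append)
    show "q \<in> ?Q \<longleftrightarrow> q \<in> (if i = 0 then {ms ! i<..} else {ms ! i<..ms ! (i - 1)})"
      using i unfolding strict_at_def mem_Collect_eq nth
        insert_nth_in_mzv_indices_iff[OF ms less_imp_le[OF i]] by (cases "i = 0") auto
  qed
  \<comment> \<open>For i = 0 this is an infinite series; otherwise the range is finite and the two
    reciprocal sums can be evaluated separately.\<close>
  have "((\<lambda>q. 1 / real (q - ms ! i) - 1 / real q) has_sum upper_weight i ms) ?Q"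
  proof (cases "i = 0")
    case True
    thus ?thesis unfolding Q by (simp add: upper_weight_def has_sum_reciprocal_diff_greaterThan)
  next
    case False
    have le: "ms ! i \<le> ms ! (i - 1)" using ms i by (intro mzv_indices_nth_mono) auto
    have "upper_weight i ms = (\<Sum>q\<in>?Q. 1 / real (q - ms ! i) - 1 / real q)"
      unfolding Q sum_subtractf using False
      by (simp only: if_False sum_reciprocal_Ioc[OF le] sum_reciprocal_diff_Ioc[OF le]
            upper_weight_def)
    thus ?thesis using False unfolding Q by (intro has_sum_finiteI) auto
  qed
  from has_sum_cmult_right[OF this, of "zeta_term ks ms"]
  show "((\<lambda>q. zeta_term ks (delete_nth i (insert_nth i q ms)) *
      (1 / real (insert_nth i q ms ! i - insert_nth i q ms ! Suc i) - 1 / real (insert_nth i q ms ! i)))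
    has_sum zeta_term ks ms * upper_weight i ms) ?Q"
    using i len by (simp add: nth_append)
qed (use i nonempty pos first upper_weight_bounds in
      \<open>auto simp: strict_at_def intro!: zeta_term_mult_summable\<close>)

lemma lower_has_sum:
  assumes i: "i < length ks"
  shows "((\<lambda>l. zeta_term ks (delete_nth (Suc i) l) * (1 / real (l ! i - l ! Suc i)))
    has_sum (\<Sum>\<^sub>\<infinity>ms\<in>mzv_indices (length ks). zeta_term ks ms * lower_weight i ms)) (strict_at i)"
proof (rule has_sum_insert_nth[where j = "Suc i"])
  fix ms assume ms: "ms \<in> mzv_indices (length ks)"
  hence len: "length ms = length ks" by (rule length_mzv_indices)
  let ?Q = "{q. insert_nth (Suc i) q ms \<in> strict_at i}"
  \<comment> \<open>When nothing follows the inserted entry, positivity alone bounds it below, hence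
    the default 1.\<close>
  let ?b = "if Suc i < length ks then ms ! Suc i else 1"
  have b: "0 < ?b" "?b \<le> ms ! i"
    using ms i mzv_indices_nth_mono[OF ms, of i "Suc i"] mzv_indices_nth_pos[OF ms, of i]
      mzv_indices_nth_pos[OF ms, of "Suc i"] by auto
  have Q: "?Q = {?b..<ms ! i}"
  proof (rule set_eqI)
    fix q
    have nth: "insert_nth (Suc i) q ms ! i = ms ! i" "insert_nth (Suc i) q ms ! Suc i = q"
      using i len by (simp_all add: nth_append)
    show "q \<in> ?Q \<longleftrightarrow> q \<in> {?b..<ms ! i}"
      using i b unfolding strict_at_def mem_Collect_eq nth
        insert_nth_in_mzv_indices_iff[OF ms Suc_leI[OF i]] by (cases "Suc i < length ks") auto
  qed
  have "((\<lambda>p. 1 / real (ms ! i - p)) has_sum lower_weight i ms) ?Q"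
    unfolding Q lower_weight_def
    by (rule has_sum_finiteI) (use sum_reciprocal_diff_Ico[OF b(2)] in auto)
  from has_sum_cmult_right[OF this, of "zeta_term ks ms"]
  show "((\<lambda>q. zeta_term ks (delete_nth (Suc i) (insert_nth (Suc i) q ms)) *
      (1 / real (insert_nth (Suc i) q ms ! i - insert_nth (Suc i) q ms ! Suc i)))
    has_sum zeta_term ks ms * lower_weight i ms) ?Q"
    using i len by (simp add: nth_append)
qed (use i nonempty pos first lower_weight_bounds in
      \<open>auto simp: strict_at_def intro!: zeta_term_mult_summable\<close>)

section \<open>The split series on the equal and the strict part\<close>

text \<open>The summand of the inner sum over j on the right-hand side. It is an empty sum if k_i =
  1.\<close>

definition split_term :: "nat \<Rightarrow> nat list \<Rightarrow> real" where
  "split_term i l =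
    (\<Sum>j<ks ! i - 1. zeta_term (take i ks @ [ks ! i - j, j + 1] @ drop (i + 1) ks) l)"

lemma mzv_indices_split:
  assumes "l \<in> mzv_indices (Suc (length ks))" "i < length ks"
  obtains as bs where "l = as @ l ! i # l ! Suc i # bs" "length as = i"
proof
  show "l = take i l @ l ! i # l ! Suc i # drop (Suc (Suc i)) l"
    using assms by (simp add: Cons_nth_drop_Suc length_mzv_indices)
  show "length (take i l) = i" using assms by (simp add: length_mzv_indices)
qed

lemma ks_split: "i < length ks \<Longrightarrow> take i ks @ ks ! i # drop (i + 1) ks = ks"
  by (simp add: Cons_nth_drop_Suc)

lemma split_term_strict:
  assumes i: "i < length ks" and l: "l \<in> strict_at i"
  shows "split_term i l + zeta_term ks (delete_nth (Suc i) l) * (1 / real (l ! i - l ! Suc i)) =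
    zeta_term ks (delete_nth i l) * (1 / real (l ! i - l ! Suc i) - 1 / real (l ! i))"
proof -
  define q p where "q = l ! i" and "p = l ! Suc i"
  have l': "l \<in> mzv_indices (Suc (length ks))" and "p < q"
    using l by (auto simp: strict_at_def p_def q_def)
  obtain as bs where asbs: "l = as @ q # p # bs" "length as = i"
    using mzv_indices_split[OF l' i] unfolding p_def q_def by metis
  have "0 < p" using mzv_indices_nth_pos[OF l', of "Suc i"] i by (simp add: p_def)
  moreover have "0 < ks ! i" using pos i by simp
  ultimately show ?thesis
    using zeta_term_partial_fractions[of "take i ks" as p q "ks ! i" "drop (i + 1) ks" bs]
      i \<open>p < q\<close> asbs(2)
    unfolding ks_split[OF i] split_term_def asbs(1) by (simp add: nth_append)
qed

lemma split_index_summable: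
  assumes "i < length ks" "j < ks ! i - 1"
  shows "zeta_term (take i ks @ [ks ! i - j, j + 1] @ drop (i + 1) ks)
    summable_on mzv_indices (Suc (length ks))"
proof -
  let ?ks = "take i ks @ [ks ! i - j, j + 1] @ drop (i + 1) ks"
  have "length ?ks = Suc (length ks)" using assms by simp
  moreover have "zeta_term ?ks summable_on mzv_indices (length ?ks)"
  proof (rule zeta_term_summable)
    show "\<forall>k\<in>set ?ks. k > 0"
      using assms pos by (auto dest: in_set_takeD in_set_dropD)
    \<comment> \<open>For i = 0 the first exponent is k_1 - j, which is at least 2 because j < k_1 -
      1.\<close>
    show "?ks ! 0 \<ge> 2" using assms first by (cases "i = 0") (auto simp: nth_append)
  qed simp
  ultimately show ?thesis by (simp only:)
qed

lemma incremented_index_summable: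
  assumes "i < length ks"
  shows "zeta_term (take i ks @ [ks ! i + 1] @ drop (i + 1) ks) summable_on mzv_indices (length ks)"
proof -
  let ?ks = "take i ks @ [ks ! i + 1] @ drop (i + 1) ks"
  have "length ?ks = length ks" using assms by simp
  moreover have "zeta_term ?ks summable_on mzv_indices (length ?ks)"
  proof (rule zeta_term_summable)
    show "\<forall>k\<in>set ?ks. k > 0"
      using assms pos by (auto dest: in_set_takeD in_set_dropD)
    show "?ks ! 0 \<ge> 2" using assms first by (cases "i = 0") (auto simp: nth_append)
  qed simp
  ultimately show ?thesis by (simp only:)
qed

lemma split_term_has_sum:
  assumes "i < length ks"
  shows "(split_term i has_sum
    (\<Sum>j<ks ! i - 1. zeta_bar (take i ks @ [ks ! i - j, j + 1] @ drop (i + 1) ks)))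
    (mzv_indices (Suc (length ks)))"
  unfolding split_term_def[abs_def]
proof (rule has_sum_sum)
  fix j assume j: "j \<in> {..<ks ! i - 1}"
  let ?ks = "take i ks @ [ks ! i - j, j + 1] @ drop (i + 1) ks"
  have len: "length ?ks = Suc (length ks)" using assms by simp
  have "zeta_term ?ks summable_on mzv_indices (Suc (length ks))"
    using split_index_summable[OF assms, of j] j by blast
  from has_sum_infsum[OF this]
  show "(zeta_term ?ks has_sum zeta_bar ?ks) (mzv_indices (Suc (length ks)))"
    by (simp only: zeta_bar_altdef len)
qed simp

text \<open>A list in \<open>equal_at i\<close> arises from exactly one shorter list by doubling its
  entry at i, so the sum runs over the shorter lists.\<close>

lemma split_term_equal_has_sum:
  assumes i: "i < length ks"
  shows "(split_term i has_sum
    (real (ks ! i) - 1) * zeta_bar (take i ks @ [ks ! i + 1] @ drop (i + 1) ks)) (equal_at i)"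
proof -
  let ?ks = "take i ks @ [ks ! i + 1] @ drop (i + 1) ks"
  have k: "0 < ks ! i" using pos i by simp
  have "(split_term i has_sum
    (\<Sum>\<^sub>\<infinity>ms\<in>mzv_indices (length ks). (real (ks ! i) - 1) * zeta_term ?ks ms)) (equal_at i)"
  proof (rule has_sum_insert_nth[where j = i])
    fix ms assume ms: "ms \<in> mzv_indices (length ks)"
    hence len: "length ms = length ks" by (rule length_mzv_indices)
    have Q: "{q. insert_nth i q ms \<in> equal_at i} = {ms ! i}"
      using i insert_nth_in_mzv_indices_iff[OF ms, of i] mzv_indices_nth_pos[OF ms, of i]
        mzv_indices_nth_mono[OF ms, of "i - 1" i]
      by (auto simp: equal_at_def nth_append len)
    have m: "drop i ms = ms ! i # drop (Suc i) ms" "0 < ms ! i"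
      using i len mzv_indices_nth_pos[OF ms] by (auto simp: Cons_nth_drop_Suc)
    have "split_term i (insert_nth i (ms ! i) ms) = (real (ks ! i) - 1) * zeta_term ?ks ms"
      using zeta_term_equal_entries[of "take i ks" "take i ms" "ms ! i" "ks ! i"
          "drop (i + 1) ks" "drop (Suc i) ms"] i len m k
      unfolding split_term_def m(1)
      by (simp add: id_take_nth_drop[symmetric])
    thus "((\<lambda>q. split_term i (insert_nth i q ms)) has_sum (real (ks ! i) - 1) * zeta_term ?ks ms)
        {q. insert_nth i q ms \<in> equal_at i}"
      unfolding Q by (intro has_sum_finiteI) auto
  qed (use i incremented_index_summable in
        \<open>auto simp: equal_at_def split_term_def intro!: sum_nonneg summable_on_cmult_right\<close>)
  moreover have "length ?ks = length ks" using i by simp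
  ultimately show ?thesis by (simp only: infsum_cmult_right' zeta_bar_altdef)
qed

text \<open>Neighbouring entries are equal or strictly decreasing. The equal part gives the
  incremented index; on the strict part \<open>split_term_strict\<close> trades the split series
  plus the lower-weighted series for the upper-weighted one.\<close>

lemma sum_split_index:
  assumes i: "i < length ks"
  shows "(\<Sum>j<ks ! i - 1. zeta_bar (take i ks @ [ks ! i - j, j + 1] @ drop (i + 1) ks)) +
      (\<Sum>\<^sub>\<infinity>ms\<in>mzv_indices (length ks). zeta_term ks ms * lower_weight i ms) =
    (real (ks ! i) - 1) * zeta_bar (take i ks @ [ks ! i + 1] @ drop (i + 1) ks) +
      (\<Sum>\<^sub>\<infinity>ms\<in>mzv_indices (length ks). zeta_term ks ms * upper_weight i ms)"
    (is "?S + ?L = ?E + ?U")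
proof -
  have "split_term i summable_on strict_at i"
    by (rule summable_on_subset_banach[OF has_sum_imp_summable[OF split_term_has_sum[OF i]]])
       (auto simp: strict_at_def)
  note D = has_sum_infsum[OF this]
  have un: "mzv_indices (Suc (length ks)) = equal_at i \<union> strict_at i"
    using i mzv_indices_nth_mono[of _ "Suc (length ks)" i "Suc i"]
    by (fastforce simp: equal_at_def strict_at_def)
  have "equal_at i \<inter> strict_at i = {}"
    by (auto simp: equal_at_def strict_at_def)
  from has_sum_Un_disjoint[OF split_term_equal_has_sum[OF i] D this]
  have "(split_term i has_sum ?E + infsum (split_term i) (strict_at i))
      (mzv_indices (Suc (length ks)))"
    by (simp only: un)
  hence "?S = ?E + infsum (split_term i) (strict_at i)"
    using split_term_has_sum[OF i] has_sum_unique by blast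
  moreover have "infsum (split_term i) (strict_at i) + ?L = ?U"
    using has_sum_add[OF D lower_has_sum[OF i]] upper_has_sum[OF i]
    by (subst (asm) has_sum_cong[OF split_term_strict[OF i]]) (auto intro: has_sum_unique)
  ultimately show ?thesis by simp
qed

text \<open>\<open>sum_weights\<close> multiplied by the summand and summed over all lists; the
  surplus 1/m_n raises the last exponent.\<close>

lemma sum_upper_lower:
  defines "r \<equiv> length ks - 1"
  shows "(\<Sum>i<length ks. \<Sum>\<^sub>\<infinity>ms\<in>mzv_indices (length ks). zeta_term ks ms * upper_weight i ms) =
    (\<Sum>i<length ks. \<Sum>\<^sub>\<infinity>ms\<in>mzv_indices (length ks). zeta_term ks ms * lower_weight i ms) +
    zeta_bar (take r ks @ [ks ! r + 1] @ drop (r + 1) ks)"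
proof -
  let ?ks = "take r ks @ [ks ! r + 1] @ drop (r + 1) ks"
  let ?M = "mzv_indices (length ks)"
  have r: "r < length ks" "length ks = Suc r" using length_pos by (auto simp: r_def)
  have U: "((\<lambda>ms. \<Sum>i<length ks. zeta_term ks ms * upper_weight i ms) has_sum
      (\<Sum>i<length ks. \<Sum>\<^sub>\<infinity>ms\<in>?M. zeta_term ks ms * upper_weight i ms)) ?M"
    by (intro has_sum_sum has_sum_infsum zeta_term_mult_summable)
       (use nonempty pos first upper_weight_bounds in auto)
  have "((\<lambda>ms. \<Sum>i<length ks. zeta_term ks ms * lower_weight i ms) has_sum
      (\<Sum>i<length ks. \<Sum>\<^sub>\<infinity>ms\<in>?M. zeta_term ks ms * lower_weight i ms)) ?M"
    by (intro has_sum_sum has_sum_infsum zeta_term_mult_summable)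
       (use nonempty pos first lower_weight_bounds in auto)
  moreover have "(zeta_term ?ks has_sum zeta_bar ?ks) ?M"
    using has_sum_infsum[OF incremented_index_summable[OF r(1)]] r
    by (simp add: zeta_bar_altdef)
  ultimately have "((\<lambda>ms. (\<Sum>i<length ks. zeta_term ks ms * lower_weight i ms) + zeta_term ?ks ms) has_sum
      (\<Sum>i<length ks. \<Sum>\<^sub>\<infinity>ms\<in>?M. zeta_term ks ms * lower_weight i ms) + zeta_bar ?ks) ?M"
    by (rule has_sum_add)
  also have "?this \<longleftrightarrow> ((\<lambda>ms. \<Sum>i<length ks. zeta_term ks ms * upper_weight i ms) has_sum
      (\<Sum>i<length ks. \<Sum>\<^sub>\<infinity>ms\<in>?M. zeta_term ks ms * lower_weight i ms) + zeta_bar ?ks) ?M"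
  proof (rule has_sum_cong)
    fix ms assume ms: "ms \<in> ?M"
    hence "length ms = Suc r" using r by (simp add: length_mzv_indices)
    hence mr: "ms = take r ms @ [ms ! r]" using id_take_nth_drop[of r ms] by simp
    have kr: "ks = take r ks @ [ks ! r]" using id_take_nth_drop[of r ks] r by simp
    have len: "length (take r ks) = length (take r ms)" using \<open>length ms = Suc r\<close> r by simp
    have "zeta_term ?ks ms = zeta_term (take r ks @ [ks ! r + 1]) (take r ms @ [ms ! r])"
      using r mr by simp
    also have "\<dots> = zeta_term (take r ks @ [ks ! r]) (take r ms @ [ms ! r]) * (1 / real (ms ! r))"
      using len by (simp add: zeta_term_append)
    also have "\<dots> = zeta_term ks ms * (1 / real (ms ! r))"
      by (simp only: mr[symmetric] kr[symmetric])
    finally show "(\<Sum>i<length ks. zeta_term ks ms * lower_weight i ms) + zeta_term ?ks ms =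
        (\<Sum>i<length ks. zeta_term ks ms * upper_weight i ms)"
      using sum_weights[OF ms] by (simp add: r_def ring_distribs flip: sum_distrib_left)
  qed
  finally show ?thesis using U has_sum_unique by blast
qed

end

section \<open>Assembling the sum formula\<close>

theorem theorem3p3:
  fixes ks :: "nat list"
  assumes "ks \<noteq> []"
    and "\<forall>k\<in>set ks. k > 0"
    and "ks ! 0 \<ge> 2"
  shows "(\<Sum>i<length ks. (real (ks ! i) - 1 + (if i = length ks - 1 then 1 else 0))
            * zeta_bar (take i ks @ [ks ! i + 1] @ drop (i + 1) ks))
       = (\<Sum>i | i < length ks \<and> ks ! i \<ge> 2. \<Sum>j=0..ks ! i - 2.
            zeta_bar (take i ks @ [ks ! i - j, j + 1] @ drop (i + 1) ks))"
proof -
  interpret admissible_index ks by unfold_locales fact+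
  let ?z = "\<lambda>i. zeta_bar (take i ks @ [ks ! i + 1] @ drop (i + 1) ks)"
  let ?s = "\<lambda>i j. zeta_bar (take i ks @ [ks ! i - j, j + 1] @ drop (i + 1) ks)"
  have "(\<Sum>i | i < length ks \<and> ks ! i \<ge> 2. \<Sum>j=0..ks ! i - 2. ?s i j) =
        (\<Sum>i<length ks. \<Sum>j<ks ! i - 1. ?s i j)"
  proof (rule sum.mono_neutral_cong_left)
    fix i assume "i \<in> {i. i < length ks \<and> ks ! i \<ge> 2}"
    hence "{0..ks ! i - 2} = {..<ks ! i - 1}" by auto
    thus "(\<Sum>j=0..ks ! i - 2. ?s i j) = (\<Sum>j<ks ! i - 1. ?s i j)" by simp
  next
    \<comment> \<open>For k_i = 1 the range \<open>{..<ks ! i - 1}\<close> is empty, whereas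
      truncated subtraction would turn \<open>{0..ks ! i - 2}\<close> into {0}. Only the former
      allows summing over all positions.\<close>
    show "\<forall>i\<in>{..<length ks} - {i. i < length ks \<and> ks ! i \<ge> 2}. (\<Sum>j<ks ! i - 1. ?s i j) = 0"
    proof
      fix i assume "i \<in> {..<length ks} - {i. i < length ks \<and> ks ! i \<ge> 2}"
      hence "ks ! i - 1 = 0" by auto
      thus "(\<Sum>j<ks ! i - 1. ?s i j) = 0" by (simp only: lessThan_0 sum.empty)
    qed
  qed auto
  also have "\<dots> = (\<Sum>i<length ks. (real (ks ! i) - 1) * ?z i) + ?z (length ks - 1)"
  proof -
    have "(\<Sum>i<length ks. (\<Sum>j<ks ! i - 1. ?s i j) +
        (\<Sum>\<^sub>\<infinity>ms\<in>mzv_indices (length ks). zeta_term ks ms * lower_weight i ms)) =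
      (\<Sum>i<length ks. (real (ks ! i) - 1) * ?z i +
        (\<Sum>\<^sub>\<infinity>ms\<in>mzv_indices (length ks). zeta_term ks ms * upper_weight i ms))"
      using sum_split_index by (intro sum.cong) auto
    \<comment> \<open>The upper-weighted series exceed the lower-weighted ones by exactly the value
      with the last exponent raised.\<close>
    thus ?thesis using sum_upper_lower by (simp only: sum.distrib)
  qed
  also have "?z (length ks - 1) =
      (\<Sum>i<length ks. (if i = length ks - 1 then 1 else 0) * ?z i)"
    using length_pos by (simp add: if_distrib[of "\<lambda>x. x * _"] cong: if_cong)
  finally show ?thesis by (simp add: distrib_right sum.distrib)
qed

end
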